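(* Let $0<q\le\infty$, $0<p\le t<\infty$ and $0<r\le\infty$. There exists a constant $C_{q,p,n,r}>0$ depending on $q,p,n,r$ such that for all $y\in\mathbb R^n$ and $f\in M_{p,q}^{t,r}(\mathbb R^n)$, $$\|f(\cdot-y)\|_{M_{p,q}^{t,r}(\mathbb R^n)}\le C_{q,p,n,r}\|f\|_{M_{p,q}^{t,r}(\mathbb R^n)}.$$
   Context: Lorentz norm: with $d_f(s)=|\{x:|f(x)|>s\}|$ and $f^*(u)=\inf\{s>0:d_f(s)\le u\}$, $\|f\|_{L^{p,q}}=\left(\int_0^\infty(u^{1/p}f^*(u))^q\frac{du}{u}\right)^{1/q}$ for $q<\infty$ and $\|f\|_{L^{p,\infty}}=\sup_{u>0}u^{1/p}f^*(u)$; $\|f\|_{L^{p,q}(Q)}=\|f\chi_Q\|_{L^{p,q}}$. Dyadic cubes: $Q_{j,m}=\prod_{i=1}^n[2^{-j}m_i,2^{-j}(m_i+1))$, $j\in\mathbb Z$, $m\in\mathbb Z^n$; $\mathcal D$ is the set of all of them. $M_{p,q}^{t,r}(\mathbb R^n)$ is the set of measurable $f$ with $\|f\|_{M_{p,q}^{t,r}(\mathbb R^n)}=\left(\sum_{Q\in\mathcal D}|Q|^{r/t-r/p}\|f\|_{L^{p,q}(Q)}^r\right)^{1/r}<\infty$ (supremum over $Q\in\mathcal D$ of $|Q|^{1/t-1/p}\|f\|_{L^{p,q}(Q)}$ if $r=\infty$). *)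

theory Defs
  imports "HOL-Analysis.Analysis"
begin

text \<open>
  Norms take values in \<^typ>\<open>ennreal\<close>, so that they are defined for every function.
  The exponents that may be infinite (\<open>q\<close> and \<open>r\<close>) are of type \<^typ>\<open>ennreal\<close>,
  the finite ones (\<open>p\<close> and \<open>t\<close>) of type \<^typ>\<open>real\<close>.
\<close>

text \<open>The power \<open>x\<^sup>a\<close> on \<open>[0,\<infinity>]\<close>; it is only used for \<open>a > 0\<close>, hence \<open>\<infinity>\<^sup>a = \<infinity>\<close>.\<close>

definition ennpowr :: "ennreal \<Rightarrow> real \<Rightarrow> ennreal" where
  "ennpowr x a = (if x = \<infinity> then \<infinity> else ennreal (enn2real x powr a))"

definition distribution_fn :: "(real ^ 'n \<Rightarrow> complex) \<Rightarrow> real \<Rightarrow> ennreal" where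
  "distribution_fn f s = emeasure lebesgue {x. norm (f x) > s}"

text \<open>The infimum of the empty set is \<open>\<infinity>\<close>, which is why it is taken in \<^typ>\<open>ennreal\<close>.\<close>

definition decr_rearr :: "(real ^ 'n \<Rightarrow> complex) \<Rightarrow> real \<Rightarrow> ennreal" where
  "decr_rearr f u = Inf {ennreal s | s. s > 0 \<and> distribution_fn f s \<le> ennreal u}"

definition lorentz_norm :: "real \<Rightarrow> ennreal \<Rightarrow> (real ^ 'n \<Rightarrow> complex) \<Rightarrow> ennreal" where
  "lorentz_norm p q f =
     (if q = \<infinity> then (SUP u\<in>{0<..}. ennreal (u powr (1 / p)) * decr_rearr f u)
      else ennpowr
        (\<integral>\<^sup>+u\<in>{0<..}. ennpowr (ennreal (u powr (1 / p)) * decr_rearr f u) (enn2real q)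
                        * ennreal (1 / u) \<partial>lborel)
        (1 / enn2real q))"

definition lorentz_norm_on ::
  "real \<Rightarrow> ennreal \<Rightarrow> (real ^ 'n) set \<Rightarrow> (real ^ 'n \<Rightarrow> complex) \<Rightarrow> ennreal" where
  "lorentz_norm_on p q Q f = lorentz_norm p q (\<lambda>x. f x * indicator Q x)"

definition dyadic_cube :: "int \<Rightarrow> (int ^ 'n) \<Rightarrow> (real ^ 'n) set" where
  "dyadic_cube j m =
     {x. \<forall>i. x $ i \<in> {2 powi (- j) * real_of_int (m $ i) ..< 2 powi (- j) * (real_of_int (m $ i) + 1)}}"

definition dyadic_cubes :: "(real ^ 'n) set set" where
  "dyadic_cubes = {dyadic_cube j m | j m. True}"

definition blm_norm ::
  "real \<Rightarrow> ennreal \<Rightarrow> real \<Rightarrow> ennreal \<Rightarrow> (real ^ 'n \<Rightarrow> complex) \<Rightarrow> ennreal" where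
  "blm_norm p q t r f =
     (if r = \<infinity>
      then (SUP Q\<in>dyadic_cubes.
              ennreal (measure lebesgue Q powr (1 / t - 1 / p)) * lorentz_norm_on p q Q f)
      else ennpowr
        (\<Sum>\<^sub>\<infinity>Q\<in>dyadic_cubes.
           ennreal (measure lebesgue Q powr (enn2real r / t - enn2real r / p))
           * ennpowr (lorentz_norm_on p q Q f) (enn2real r))
        (1 / enn2real r))"

definition blm_space :: "real \<Rightarrow> ennreal \<Rightarrow> real \<Rightarrow> ennreal \<Rightarrow> (real ^ 'n \<Rightarrow> complex) set" where
  "blm_space p q t r = {f. f \<in> borel_measurable lebesgue \<and> blm_norm p q t r f < \<infinity>}"

end

theory Submission
  imports Defs
begin

text \<open>
  Translating by \<open>y\<close> turns the restriction of \<open>f(\<cdot> - y)\<close> to a dyadic cube \<open>Q\<close> into the restriction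
  of \<open>f\<close> to \<open>Q - y\<close>, which is covered by \<open>2\<^sup>n\<close> dyadic cubes of the same generation. If \<open>|h|\<close> is
  controlled by \<open>N\<close> functions \<open>g\<^sub>k\<close> in the sense that \<open>d\<^sub>h \<le> \<Sum>\<^sub>k d\<^bsub>g\<^sub>k\<^esub>\<close>, then
  \<open>h\<^sup>*(u) \<le> max\<^sub>k g\<^sub>k\<^sup>*(u/N)\<close>, so by scaling the Lorentz quasinorm of \<open>h\<close> is at most
  \<open>N\<^bsup>1/p + 1/q\<^esup>\<close> times the largest of those of the \<open>g\<^sub>k\<close>. For each of the \<open>2\<^sup>n\<close> relative positions
  the map from \<open>Q\<close> to the covering cube is injective, and the cubes have the same volume, so summation
  over \<open>Q\<close> costs a factor \<open>2\<^bsup>n/r\<^esup>\<close> only.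
\<close>

section \<open>Powers of extended nonnegative reals\<close>

lemma ennpowr_mono:
  assumes "x \<le> y" "0 \<le> a"
  shows "ennpowr x a \<le> ennpowr y a"
proof (cases "y = \<infinity>")
  case False
  then have "x < \<infinity>" "y < \<infinity>"
    using assms(1) by (auto simp: top.not_eq_extremum)
  then have "enn2real x \<le> enn2real y"
    using assms(1) by (simp add: enn2real_mono)
  with \<open>x < \<infinity>\<close> \<open>y < \<infinity>\<close> show ?thesis
    using assms(2) by (auto simp: ennpowr_def intro!: ennreal_leI powr_mono2)
qed (simp add: ennpowr_def)

lemma ennpowr_ennreal: "0 \<le> x \<Longrightarrow> ennpowr (ennreal x) a = ennreal (x powr a)"
  by (simp add: ennpowr_def)

lemma ennpowr_0 [simp]: "ennpowr 0 a = 0"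
  by (simp add: ennpowr_def)

lemma ennpowr_eq_0_iff [simp]: "ennpowr x a = 0 \<longleftrightarrow> x = 0"
  by (cases x) (auto simp: ennpowr_def)

text \<open>When a factor is infinite, both sides agree by convention: if the other factor is 0 then
  \<open>\<infinity> * 0 = 0\<close> and \<open>0 powr a = 0\<close>, otherwise both sides are
  infinite.\<close>

lemma ennpowr_mult: "ennpowr (x * y) a = ennpowr x a * ennpowr y a"
proof (cases "x = \<infinity> \<or> y = \<infinity>")
  case True
  have top: "ennpowr (\<infinity> * z) a = ennpowr \<infinity> a * ennpowr z a" for z
  proof (cases "z = 0")
    case False
    then have "\<infinity> * z = \<infinity>" "\<infinity> * ennpowr z a = \<infinity>"
      by (simp_all add: ennreal_top_mult)
    then show ?thesis by (simp add: ennpowr_def)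
  qed simp
  from True show ?thesis
  proof
    assume "y = \<infinity>"
    then show ?thesis using top[of x] by (simp only: mult.commute)
  qed (simp only: top)
next
  case False
  then obtain b c where "x = ennreal b" "0 \<le> b" "y = ennreal c" "0 \<le> c"
    by (cases x; cases y) auto
  then show ?thesis
    by (simp add: ennpowr_ennreal ennreal_mult[symmetric] powr_mult)
qed

text \<open>A finite nonempty supremum is attained, so monotonicity of the power gives both
  inequalities.\<close>

lemma ennpowr_SUP:
  assumes "finite E" "E \<noteq> {}" "0 \<le> a"
  shows "ennpowr (SUP k\<in>E. x k) a = (SUP k\<in>E. ennpowr (x k) a)"
proof (rule antisym)
  have "(SUP k\<in>E. x k) \<in> x ` E"
    using Max_in[of "x ` E"] Max_Sup[of "x ` E"] assms by simp
  then show "ennpowr (SUP k\<in>E. x k) a \<le> (SUP k\<in>E. ennpowr (x k) a)"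
    by (metis (mono_tags, lifting) SUP_upper image_iff)
qed (auto intro!: SUP_least ennpowr_mono SUP_upper assms)

lemma SUP_le_sum_ennreal:
  fixes x :: "'a \<Rightarrow> ennreal"
  assumes "finite E"
  shows "(SUP k\<in>E. x k) \<le> (\<Sum>k\<in>E. x k)"
  using assms by (auto intro!: SUP_least member_le_sum)

lemma borel_measurable_ennpowr [measurable]:
  assumes [measurable]: "f \<in> borel_measurable M"
  shows "(\<lambda>x. ennpowr (f x) a) \<in> borel_measurable M"
  unfolding ennpowr_def by measurable

section \<open>Decreasing rearrangements and Lorentz norms\<close>

lemma superlevel_in_sets_lebesgue:
  fixes f :: "real ^ 'n \<Rightarrow> complex"
  assumes [measurable]: "f \<in> borel_measurable lebesgue"
  shows "{x. norm (f x) > s} \<in> sets lebesgue"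
proof -
  have "{x \<in> space lebesgue. norm (f x) > s} \<in> sets lebesgue" by measurable
  then show ?thesis by simp
qed

lemma distribution_fn_antimono:
  assumes "f \<in> borel_measurable lebesgue" "s \<le> s'"
  shows "distribution_fn f s' \<le> distribution_fn f s"
  unfolding distribution_fn_def using assms
  by (intro emeasure_mono superlevel_in_sets_lebesgue) auto

lemma decr_rearr_antimono: "u \<le> v \<Longrightarrow> decr_rearr f v \<le> decr_rearr f u"
  unfolding decr_rearr_def
  by (rule Inf_superset_mono) (use order_trans[OF _ ennreal_leI] in blast)

text \<open>The superlevel sets of an antitone function on the line are intervals.\<close>

lemma borel_measurable_decr_rearr [measurable]: "decr_rearr f \<in> borel_measurable borel"
proof (rule borel_measurableI_ge)
  fix c
  have "is_interval {u. c \<le> decr_rearr f u}"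
    unfolding is_interval_1 using decr_rearr_antimono[of _ _ f] by (auto intro: order_trans)
  then show "{u \<in> space borel. c \<le> decr_rearr f u} \<in> sets borel"
    by (simp add: real_interval_borel_measurable)
qed

text \<open>The infimum defining the rearrangement may not be attained, but strict inequality yields
  an admissible level below \<open>s\<close>, and the distribution function decreases from there to
  \<open>s\<close>.\<close>

lemma distribution_fn_le_of_decr_rearr_less:
  assumes "f \<in> borel_measurable lebesgue" "decr_rearr f u < ennreal s"
  shows "distribution_fn f s \<le> ennreal u"
proof -
  obtain s' where "0 < s'" "distribution_fn f s' \<le> ennreal u" "ennreal s' < ennreal s"
    using assms(2) unfolding decr_rearr_def Inf_less_iff by auto
  then show ?thesis
    using distribution_fn_antimono[OF assms(1), of s' s] by (auto simp: ennreal_less_iff)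
qed

text \<open>A level \<open>s\<close> above every rearrangement at \<open>u / card E\<close> leaves
  each \<open>g k\<close> a superlevel set of measure at most \<open>u / card E\<close>. The
  \<open>card E\<close> bounds add up to \<open>u\<close>, so \<open>s\<close> is admissible in the
  infimum for \<open>h\<close>.\<close>

lemma decr_rearr_le_SUP:
  fixes h :: "real ^ 'n \<Rightarrow> complex"
  assumes E: "finite E" "E \<noteq> {}"
    and g: "\<And>k. k \<in> E \<Longrightarrow> g k \<in> borel_measurable lebesgue"
    and le: "\<And>s. 0 < s \<Longrightarrow> distribution_fn h s \<le> (\<Sum>k\<in>E. distribution_fn (g k) s)"
    and u: "0 < u"
  shows "decr_rearr h u \<le> (SUP k\<in>E. decr_rearr (g k) (u / real (card E)))"
proof (rule dense_ge)
  fix c assume c: "(SUP k\<in>E. decr_rearr (g k) (u / real (card E))) < c"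
  show "decr_rearr h u \<le> c"
  proof (cases c)
    case (real s)
    then have "0 < s" using c by (cases "s = 0") auto
    have "distribution_fn (g k) s \<le> ennreal (u / real (card E))" if "k \<in> E" for k
    proof (rule distribution_fn_le_of_decr_rearr_less[OF g[OF that]])
      show "decr_rearr (g k) (u / real (card E)) < ennreal s"
        using c unfolding real(2) by (rule le_less_trans[OF SUP_upper[OF that]])
    qed
    then have "distribution_fn h s \<le> (\<Sum>k\<in>E. ennreal (u / real (card E)))"
      by (intro order_trans[OF le[OF \<open>0 < s\<close>]] sum_mono)
    also have "\<dots> = ennreal u"
    proof -
      have "(\<Sum>k\<in>E. ennreal (u / real (card E))) = ennreal (\<Sum>k\<in>E. u / real (card E))"
        using u by (intro sum_ennreal) auto
      then show ?thesis using E u by simp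
    qed
    finally show ?thesis
      unfolding decr_rearr_def real using \<open>0 < s\<close> by (intro Inf_lower) blast
  qed simp
qed

text \<open>The measure \<open>du / u\<close> is invariant under dilations; the substitution is
  \<open>u = c * v\<close>.\<close>

lemma nn_integral_dilation_inverse:
  fixes G :: "real \<Rightarrow> ennreal"
  assumes [measurable]: "G \<in> borel_measurable borel" and c: "0 < c"
  shows "(\<integral>\<^sup>+u\<in>{0<..}. G (u / c) * ennreal (1 / u) \<partial>lborel) =
         (\<integral>\<^sup>+u\<in>{0<..}. G u * ennreal (1 / u) \<partial>lborel)"
proof -
  have "(\<integral>\<^sup>+u\<in>{0<..}. G (u / c) * ennreal (1 / u) \<partial>lborel) =
      ennreal \<bar>c\<bar> * (\<integral>\<^sup>+v. G ((0 + c * v) / c) * ennreal (1 / (0 + c * v))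
        * indicator {0<..} (0 + c * v) \<partial>lborel)"
    using c by (intro nn_integral_real_affine) auto
  also have "\<dots> = (\<integral>\<^sup>+v. ennreal c * (G ((0 + c * v) / c) * ennreal (1 / (0 + c * v))
        * indicator {0<..} (0 + c * v)) \<partial>lborel)"
    using c by (simp add: nn_integral_cmult)
  also have "\<dots> = (\<integral>\<^sup>+u\<in>{0<..}. G u * ennreal (1 / u) \<partial>lborel)"
  proof (rule nn_integral_cong)
    fix v :: real
    have "ennreal c * (G v * ennreal (1 / (c * v))) = G v * ennreal (1 / v)" if "0 < v"
    proof -
      have "ennreal c * ennreal (1 / (c * v)) = ennreal (1 / v)"
        using c that by (subst ennreal_mult[symmetric]) auto
      then show ?thesis by (metis mult.left_commute)
    qed
    then show "ennreal c * (G ((0 + c * v) / c) * ennreal (1 / (0 + c * v))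
        * indicator {0<..} (0 + c * v)) = G v * ennreal (1 / v) * indicator {0<..} v"
      using c by (auto simp: indicator_def zero_less_mult_iff)
  qed
  finally show ?thesis .
qed

text \<open>For \<open>q = \<infinity>\<close> the term \<open>1 / enn2real q\<close> is \<open>1 / 0 = 0\<close>, the intended value.\<close>

lemma lorentz_norm_le_SUP:
  fixes h :: "real ^ 'n \<Rightarrow> complex"
  assumes p: "0 < p" and q: "0 < q"
    and E: "finite E" "E \<noteq> {}"
    and g: "\<And>k. k \<in> E \<Longrightarrow> g k \<in> borel_measurable lebesgue"
    and le: "\<And>s. 0 < s \<Longrightarrow> distribution_fn h s \<le> (\<Sum>k\<in>E. distribution_fn (g k) s)"
  shows "lorentz_norm p q h
    \<le> ennreal (real (card E) powr (1 / p + 1 / enn2real q)) * (SUP k\<in>E. lorentz_norm p q (g k))"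
proof -
  define N where "N = real (card E)"
  define w where "w k u = ennreal (u powr (1 / p)) * decr_rearr (g k) u" for k u
  have N: "0 < N" using E by (simp add: N_def card_gt_0_iff)
  have pointwise: "ennreal (u powr (1 / p)) * decr_rearr h u
      \<le> ennreal (N powr (1 / p)) * (SUP k\<in>E. w k (u / N))" if u: "0 < u" for u
  proof -
    have "ennreal (u powr (1 / p)) * decr_rearr h u
        \<le> ennreal (u powr (1 / p)) * (SUP k\<in>E. decr_rearr (g k) (u / N))"
      unfolding N_def by (intro mult_left_mono decr_rearr_le_SUP[OF E g le u]) auto
    \<comment> \<open>The weight is moved to the dilated point \<open>u / N\<close>, which is the
      source of the factor \<open>N powr (1 / p)\<close>.\<close>
    also have "\<dots> = ennreal (N powr (1 / p) * (u / N) powr (1 / p))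
        * (SUP k\<in>E. decr_rearr (g k) (u / N))"
      using N u by (simp add: powr_mult[symmetric])
    also have "\<dots>
        = ennreal (N powr (1 / p)) * (SUP k\<in>E. w k (u / N))"
      by (simp add: w_def ennreal_mult mult.assoc SUP_mult_left_ennreal)
    finally show ?thesis .
  qed
  show ?thesis
  proof (cases "q = \<infinity>")
    case True
    have "lorentz_norm p q h \<le> ennreal (N powr (1 / p)) * (SUP k\<in>E. lorentz_norm p q (g k))"
    proof -
      have "w k (u / N) \<le> lorentz_norm p q (g k)" if "0 < u" for k u
        unfolding lorentz_norm_def True w_def using N that by (auto intro!: SUP_upper)
      then have "ennreal (u powr (1 / p)) * decr_rearr h u
          \<le> ennreal (N powr (1 / p)) * (SUP k\<in>E. lorentz_norm p q (g k))" if "0 < u" for u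
        using that by (intro order_trans[OF pointwise] mult_left_mono SUP_mono') auto
      then show ?thesis
        unfolding lorentz_norm_def[of p q h] using True by (auto intro: SUP_least)
    qed
    then show ?thesis by (simp add: N_def True)
  next
    case False
    define a where "a = enn2real q"
    have a: "0 < a"
      using q False by (simp add: a_def enn2real_positive_iff top.not_eq_extremum)
    define I where "I k = (\<integral>\<^sup>+u\<in>{0<..}. ennpowr (w k u) a * ennreal (1 / u) \<partial>lborel)" for k
    have w_meas [measurable]: "w k \<in> borel_measurable borel" for k
      unfolding w_def by measurable
    have norm_g: "lorentz_norm p q (g k) = ennpowr (I k) (1 / a)" for k
      using False by (simp add: lorentz_norm_def I_def w_def a_def)
    have "(\<integral>\<^sup>+u\<in>{0<..}. ennpowr (ennreal (u powr (1 / p)) * decr_rearr h u) a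
              * ennreal (1 / u) \<partial>lborel)
        \<le> (\<integral>\<^sup>+u. ennreal (N powr (a / p)) * (\<Sum>k\<in>E. ennpowr (w k (u / N)) a
              * ennreal (1 / u) * indicator {0<..} u) \<partial>lborel)"
    proof (rule nn_integral_mono)
      fix u :: real
      have "ennpowr (ennreal (u powr (1 / p)) * decr_rearr h u) a
          \<le> ennreal (N powr (a / p)) * (\<Sum>k\<in>E. ennpowr (w k (u / N)) a)" if "0 < u"
      proof -
        have "ennpowr (ennreal (u powr (1 / p)) * decr_rearr h u) a
            \<le> ennpowr (ennreal (N powr (1 / p)) * (SUP k\<in>E. w k (u / N))) a"
          using pointwise[OF that] a by (intro ennpowr_mono) auto
        also have "\<dots> = ennreal (N powr (a / p)) * (SUP k\<in>E. ennpowr (w k (u / N)) a)"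
          using a E by (simp add: ennpowr_mult ennpowr_ennreal ennpowr_SUP powr_powr)
        \<comment> \<open>The supremum gives way to a sum because a finite sum can be exchanged with
          the integral.\<close>
        also have "\<dots> \<le> ennreal (N powr (a / p)) * (\<Sum>k\<in>E. ennpowr (w k (u / N)) a)"
          by (intro mult_left_mono SUP_le_sum_ennreal E) auto
        finally show ?thesis .
      qed
      then show "ennpowr (ennreal (u powr (1 / p)) * decr_rearr h u) a * ennreal (1 / u)
            * indicator {0<..} u
          \<le> ennreal (N powr (a / p)) * (\<Sum>k\<in>E. ennpowr (w k (u / N)) a
              * ennreal (1 / u) * indicator {0<..} u)"
        by (auto simp: indicator_def sum_distrib_right[symmetric] mult.assoc[symmetric]
            intro: mult_right_mono)
    qed
    also have "\<dots> = ennreal (N powr (a / p)) * (\<Sum>k\<in>E. I k)"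
    proof -
      have "(\<integral>\<^sup>+u\<in>{0<..}. ennpowr (w k (u / N)) a * ennreal (1 / u) \<partial>lborel) = I k" for k
        unfolding I_def using nn_integral_dilation_inverse[of "\<lambda>u. ennpowr (w k u) a" N] N by simp
      then show ?thesis
        by (simp add: nn_integral_cmult nn_integral_sum)
    qed
    \<comment> \<open>Returning from the sum to the supremum costs a factor \<open>N\<close>, which
      becomes \<open>N powr (1 / a)\<close> after the root is taken.\<close>
    also have "\<dots> \<le> ennreal (N powr (a / p)) * (ennreal N * (SUP k\<in>E. I k))"
      using sum_bounded_above[of E I "SUP k\<in>E. I k"]
      by (intro mult_left_mono) (simp_all add: SUP_upper N_def ennreal_of_nat_eq_real_of_nat)
    finally have "lorentz_norm p q h
        \<le> ennpowr (ennreal (N powr (a / p)) * (ennreal N * (SUP k\<in>E. I k))) (1 / a)"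
      using False a by (auto simp: lorentz_norm_def a_def intro!: ennpowr_mono)
    also have "\<dots> = ennreal (N powr (1 / p + 1 / a)) * (SUP k\<in>E. lorentz_norm p q (g k))"
      using N a E by (simp add: ennpowr_mult ennpowr_ennreal ennpowr_SUP norm_g powr_powr
          powr_add ennreal_mult mult.assoc)
    finally show ?thesis by (simp add: N_def a_def)
  qed
qed

section \<open>Dyadic cubes\<close>

text \<open>A cube determines its coordinate projections, and these nonempty half-open intervals
  determine their endpoints. Their length gives \<open>j\<close>, then the left endpoints give
  \<open>m\<close>. Sums over cubes can therefore be indexed by pairs without repetition.\<close>

lemma inj_dyadic_cube: "inj (case_prod (dyadic_cube :: int \<Rightarrow> int ^ 'n \<Rightarrow> _))"
proof (rule injI, clarsimp)
  fix j j' :: int and m m' :: "int ^ 'n"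
  assume eq: "dyadic_cube j m = dyadic_cube j' m'"
  define I :: "int \<Rightarrow> int ^ 'n \<Rightarrow> 'n \<Rightarrow> real set"
    where "I j m i = {2 powi (- j) * real_of_int (m $ i) ..<
      2 powi (- j) * (real_of_int (m $ i) + 1)}" for j m i
  have proj: "(\<lambda>x. x $ i) ` dyadic_cube j m = I j m i" for j m i
  proof (intro set_eqI iffI)
    fix z assume z: "z \<in> I j m i"
    \<comment> \<open>The other coordinates are taken from the lower corner of the cube.\<close>
    define x :: "real ^ 'n"
      where "x = (\<chi> k. if k = i then z else 2 powi (- j) * real_of_int (m $ k))"
    have "x \<in> dyadic_cube j m"
      using z by (auto simp: x_def dyadic_cube_def I_def)
    moreover have "z = x $ i" by (simp add: x_def)
    ultimately show "z \<in> (\<lambda>x. x $ i) ` dyadic_cube j m" by blast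
  qed (auto simp: dyadic_cube_def I_def)
  have *: "2 powi (- j) * real_of_int (m $ i) = 2 powi (- j') * real_of_int (m' $ i) \<and>
      2 powi (- j) * (real_of_int (m $ i) + 1) = 2 powi (- j') * (real_of_int (m' $ i) + 1)" for i
  proof -
    have "I j m i = I j' m' i" using proj eq by metis
    then show ?thesis
      unfolding I_def by (subst (asm) atLeastLessThan_eq_iff) (auto simp: mult_strict_left_mono)
  qed
  \<comment> \<open>Subtracting the endpoint equations leaves the side length;
    \<open>undefined\<close> serves as an arbitrary coordinate.\<close>
  have pw: "(2::real) powi (- j) = 2 powi (- j')"
    using *[of undefined] by (simp add: algebra_simps)
  have "j = j'"
    using pw power_int_strict_increasing[of "- j" "- j'" "2::real"]
      power_int_strict_increasing[of "- j'" "- j" "2::real"] by (cases j j' rule: linorder_cases) auto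
  moreover have "m = m'"
    using * pw by (simp add: vec_eq_iff)
  ultimately show "j = j' \<and> m = m'" ..
qed

lemma dyadic_cubes_eq_range: "dyadic_cubes = range (case_prod dyadic_cube)"
  by (auto simp: dyadic_cubes_def)

lemma dyadic_cube_in_sets_lebesgue [measurable]: "dyadic_cube j m \<in> sets lebesgue"
proof -
  have "dyadic_cube j m \<in> sets borel"
    unfolding dyadic_cube_def by measurable
  then show ?thesis by (simp add: sets_completionI_sets)
qed

lemma emeasure_lebesgue_translation:
  fixes S :: "'a::euclidean_space set"
  shows "emeasure lebesgue ((\<lambda>x. x + a) ` S) = emeasure lebesgue S"
  using emeasure_lebesgue_affine[of 1 a S] by simp

text \<open>Cubes of one generation are translates of each other. This lets the volume weight of a
  cube be replaced by that of a covering cube.\<close>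

lemma measure_dyadic_cube:
  fixes m m' :: "int ^ 'n"
  shows "measure lebesgue (dyadic_cube j m) = measure lebesgue (dyadic_cube j m')"
proof -
  define a :: "real ^ 'n" where "a = (\<chi> i. 2 powi (- j) * (real_of_int (m $ i) - real_of_int (m' $ i)))"
  have "dyadic_cube j m = (\<lambda>x. x + a) ` dyadic_cube j m'"
  proof (intro set_eqI iffI)
    fix x assume "x \<in> dyadic_cube j m"
    then have "x - a \<in> dyadic_cube j m'"
      by (simp add: a_def dyadic_cube_def algebra_simps)
    then show "x \<in> (\<lambda>x. x + a) ` dyadic_cube j m'"
      by (auto intro: image_eqI[of _ _ "x - a"])
  qed (auto simp: a_def dyadic_cube_def algebra_simps)
  then show ?thesis
    by (simp add: measure_def emeasure_lebesgue_translation)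
qed

section \<open>Covering a translated cube by dyadic cubes of the same generation\<close>

definition cube_corners :: "(int ^ 'n) set" where
  "cube_corners = range (\<lambda>b :: bool ^ 'n. \<chi> i. of_bool (b $ i))"

lemma finite_cube_corners: "finite cube_corners"
  and cube_corners_nonempty: "cube_corners \<noteq> {}"
  by (simp_all add: cube_corners_def)

text \<open>This is the index of the generation-\<open>j\<close> cube containing \<open>- y\<close>.
  The lower corner of \<open>dyadic_cube j m\<close> translated by \<open>- y\<close> thus lies in
  the cube with index \<open>m + dyadic_shift y j\<close>.\<close>

definition dyadic_shift :: "real ^ 'n \<Rightarrow> int \<Rightarrow> int ^ 'n" where
  "dyadic_shift y j = (\<chi> i. \<lfloor>- (y $ i) / 2 powi (- j)\<rfloor>)"

text \<open>In units of the side length, each coordinate of \<open>x\<close> is that of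
  \<open>x + y\<close>, with floor \<open>m $ i\<close>, plus that of \<open>- y\<close>. The floor
  of a sum of two reals is the sum of their floors, possibly plus one.\<close>

lemma dyadic_cube_translate_cover:
  fixes x y :: "real ^ 'n"
  assumes "x + y \<in> dyadic_cube j m"
  shows "\<exists>e\<in>cube_corners. x \<in> dyadic_cube j (m + dyadic_shift y j + e)"
proof -
  define s :: real where "s = 2 powi (- j)"
  have s: "0 < s" by (simp add: s_def)
  \<comment> \<open>Marks the coordinates in which the extra one occurs.\<close>
  define b :: "bool ^ 'n" where "b = (\<chi> i. \<lfloor>x $ i / s\<rfloor> \<noteq> m $ i + \<lfloor>- (y $ i) / s\<rfloor>)"
  define e :: "int ^ 'n" where "e = (\<chi> i. of_bool (b $ i))"
  have e_eq: "m $ i + \<lfloor>- (y $ i) / s\<rfloor> + e $ i = \<lfloor>x $ i / s\<rfloor>" for i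
  proof -
    have "s * real_of_int (m $ i) \<le> x $ i + y $ i" "x $ i + y $ i < s * (real_of_int (m $ i) + 1)"
      using assms by (auto simp: dyadic_cube_def s_def)
    then have "real_of_int (m $ i) \<le> (x $ i + y $ i) / s" "(x $ i + y $ i) / s < real_of_int (m $ i) + 1"
      using s by (simp_all add: field_simps)
    moreover have "(x $ i + y $ i) / s = x $ i / s - (- (y $ i) / s)"
      by (simp add: add_divide_distrib)
    ultimately have "\<lfloor>x $ i / s\<rfloor> = m $ i + \<lfloor>- (y $ i) / s\<rfloor> \<or> \<lfloor>x $ i / s\<rfloor> = m $ i + \<lfloor>- (y $ i) / s\<rfloor> + 1"
      by linarith
    then show ?thesis by (auto simp: e_def b_def)
  qed
  have *: "s * real_of_int \<lfloor>x $ i / s\<rfloor> \<le> x $ i" "x $ i < s * (real_of_int \<lfloor>x $ i / s\<rfloor> + 1)" for i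
  proof -
    have "real_of_int \<lfloor>x $ i / s\<rfloor> \<le> x $ i / s" "x $ i / s < real_of_int \<lfloor>x $ i / s\<rfloor> + 1"
      by linarith+
    then show "s * real_of_int \<lfloor>x $ i / s\<rfloor> \<le> x $ i" "x $ i < s * (real_of_int \<lfloor>x $ i / s\<rfloor> + 1)"
      using s by (simp_all only: pos_le_divide_eq pos_divide_less_eq mult.commute[of s])
  qed
  have "x \<in> dyadic_cube j (m + dyadic_shift y j + e)"
  proof -
    have "(m + dyadic_shift y j + e) $ i = \<lfloor>x $ i / s\<rfloor>" for i
      using e_eq[of i] by (simp add: dyadic_shift_def s_def)
    then show ?thesis
      using * by (simp add: dyadic_cube_def flip: s_def)
  qed
  moreover have "e \<in> cube_corners"
    by (simp add: e_def cube_corners_def)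
  ultimately show ?thesis by blast
qed

lemma lorentz_norm_on_dyadic_cube_translate:
  fixes f :: "real ^ 'n \<Rightarrow> complex"
  assumes "0 < p" "0 < q" and f [measurable]: "f \<in> borel_measurable lebesgue"
  shows "lorentz_norm_on p q (dyadic_cube j m) (\<lambda>x. f (x - y))
    \<le> ennreal (real (card (cube_corners :: (int ^ 'n) set)) powr (1 / p + 1 / enn2real q)) *
      (SUP e\<in>cube_corners. lorentz_norm_on p q (dyadic_cube j (m + dyadic_shift y j + e)) f)"
  unfolding lorentz_norm_on_def
proof (rule lorentz_norm_le_SUP[OF assms(1,2) finite_cube_corners cube_corners_nonempty])
  let ?g = "\<lambda>e x. f x * indicator (dyadic_cube j (m + dyadic_shift y j + e)) x"
  show g [measurable]: "?g e \<in> borel_measurable lebesgue" for e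
    by measurable
  fix s :: real assume s: "0 < s"
  let ?A = "\<lambda>e. {x. norm (?g e x) > s}"
  have A: "?A e \<in> sets lebesgue" for e
    by (rule superlevel_in_sets_lebesgue) (rule g)
  have sub: "{x. norm (f x * indicator (dyadic_cube j m) (x + y)) > s} \<subseteq> (\<Union>e\<in>cube_corners. ?A e)"
  proof
    fix x assume x: "x \<in> {x. norm (f x * indicator (dyadic_cube j m) (x + y)) > s}"
    \<comment> \<open>Outside the cube the restricted function is 0, which does not exceed the
      positive level \<open>s\<close>.\<close>
    then have "x + y \<in> dyadic_cube j m"
      using s by (cases "x + y \<in> dyadic_cube j m") auto
    then obtain e where "e \<in> cube_corners" "x \<in> dyadic_cube j (m + dyadic_shift y j + e)"
      using dyadic_cube_translate_cover by blast
    with x \<open>x + y \<in> dyadic_cube j m\<close> show "x \<in> (\<Union>e\<in>cube_corners. ?A e)"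
      by (intro UN_I[of e]) simp_all
  qed
  have "{x. norm (f (x - y) * indicator (dyadic_cube j m) x) > s}
      = (\<lambda>x. x + y) ` {x. norm (f x * indicator (dyadic_cube j m) (x + y)) > s}"
    by (auto intro!: image_eqI[where x = "_ - y"])
  then have "distribution_fn (\<lambda>x. f (x - y) * indicator (dyadic_cube j m) x) s
      = emeasure lebesgue {x. norm (f x * indicator (dyadic_cube j m) (x + y)) > s}"
    by (simp add: distribution_fn_def emeasure_lebesgue_translation)
  also have "\<dots> \<le> emeasure lebesgue (\<Union>e\<in>cube_corners. ?A e)"
    using A finite_cube_corners by (intro emeasure_mono sub sets.finite_UN) auto
  also have "\<dots> \<le> (\<Sum>e\<in>cube_corners. emeasure lebesgue (?A e))"
    using A finite_cube_corners by (intro emeasure_subadditive_finite) auto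
  finally show "distribution_fn (\<lambda>x. f (x - y) * indicator (dyadic_cube j m) x) s
      \<le> (\<Sum>e\<in>cube_corners. distribution_fn (?g e) s)"
    by (simp add: distribution_fn_def)
qed

section \<open>Summation over all dyadic cubes\<close>

lemma infsum_le_sum_infsum_reindex:
  fixes F H :: "'a \<Rightarrow> ennreal"
  assumes "\<And>e. e \<in> E \<Longrightarrow> inj (\<tau> e)" and "\<And>x. F x \<le> c * (\<Sum>e\<in>E. H (\<tau> e x))"
  shows "infsum F UNIV \<le> c * (of_nat (card E) * infsum H UNIV)"
proof -
  have "sum F X \<le> c * (of_nat (card E) * infsum H UNIV)" if X: "finite X" for X
  proof -
    have "sum F X \<le> (\<Sum>x\<in>X. c * (\<Sum>e\<in>E. H (\<tau> e x)))"
      by (intro sum_mono assms)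
    also have "\<dots> = c * (\<Sum>e\<in>E. \<Sum>x\<in>X. H (\<tau> e x))"
      by (subst sum.swap) (simp add: sum_distrib_left)
    also have "(\<Sum>e\<in>E. \<Sum>x\<in>X. H (\<tau> e x)) \<le> of_nat (card E) * infsum H UNIV"
    proof (rule sum_bounded_above)
      fix e assume "e \<in> E"
      \<comment> \<open>Injectivity excludes repeated terms, so this is a finite partial sum of
        \<open>H\<close>.\<close>
      then have "(\<Sum>x\<in>X. H (\<tau> e x)) = sum H (\<tau> e ` X)"
        using assms(1) by (simp add: sum.reindex inj_on_subset[OF _ subset_UNIV])
      also have "\<dots> \<le> infsum H UNIV"
        using X by (simp add: nonneg_infsum_complete SUP_upper)
      finally show "(\<Sum>x\<in>X. H (\<tau> e x)) \<le> infsum H UNIV" .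
    qed
    finally show ?thesis by (simp add: mult_left_mono)
  qed
  then show ?thesis
    by (subst nonneg_infsum_complete[of UNIV F]) (auto intro: SUP_least)
qed

theorem lemma2p13:
  fixes p :: real and q r :: ennreal
  assumes "0 < q" and "0 < p" and "0 < r"
  shows "\<exists>C::real. C > 0 \<and>
           (\<forall>t::real. p \<le> t \<longrightarrow>
             (\<forall>(y :: real ^ 'n). \<forall>f \<in> blm_space p q t r.
                blm_norm p q t r (\<lambda>x. f (x - y)) \<le> ennreal C * blm_norm p q t r f))"
proof -
  define E :: "(int ^ 'n) set" where "E = cube_corners"
  define N where "N = real (card E)"
  define K where "K = N powr (1 / p + 1 / enn2real q)"
  have E: "finite E" "E \<noteq> {}"
    by (simp_all add: E_def finite_cube_corners cube_corners_nonempty)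
  have N: "0 < N" using E by (simp add: N_def card_gt_0_iff)
  then have K: "0 < K" by (simp add: K_def)
  \<comment> \<open>The constant is free of \<open>t\<close>: the exponent \<open>t\<close> occurs
    only in the volume weights, and each cube is compared with cubes of equal volume.\<close>
  have "blm_norm p q t r (\<lambda>x. f (x - y)) \<le> ennreal (K * N powr (1 / enn2real r)) * blm_norm p q t r f"
    if f: "f \<in> blm_space p q t r" for t and y :: "real ^ 'n" and f
  proof -
    define L where "L g = (\<lambda>(j, m). lorentz_norm_on p q (dyadic_cube j m) g)" for g :: "real ^ 'n \<Rightarrow> complex"
    define V where "V b = (\<lambda>(j, m :: int ^ 'n). ennreal (measure lebesgue (dyadic_cube j m) powr b))" for b
    \<comment> \<open>\<open>\<tau> e\<close> sends the index of a cube to that of the covering cube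
      in relative position \<open>e\<close>. It keeps \<open>j\<close> and, for fixed
      \<open>j\<close>, translates \<open>m\<close> by a fixed vector, which makes it
      injective.\<close>
    define \<tau> where "\<tau> e = (\<lambda>(j, m). (j, m + dyadic_shift y j + e))" for e
    have V_\<tau>: "V b (\<tau> e x) = V b x" for b e x
      by (simp add: V_def \<tau>_def split_beta measure_dyadic_cube[of _ "snd x + _" "snd x"] add.assoc)
    have L_le: "L (\<lambda>x. f (x - y)) x \<le> ennreal K * (SUP e\<in>E. L f (\<tau> e x))" for x
      using lorentz_norm_on_dyadic_cube_translate[OF assms(2,1), of f] f
      by (auto simp: L_def \<tau>_def E_def N_def K_def blm_space_def split_beta)
    show ?thesis
    proof (cases "r = \<infinity>")
      case True
      have norm_eq: "blm_norm p q t r g = (SUP x. V (1 / t - 1 / p) x * L g x)" for g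
        by (simp add: blm_norm_def True dyadic_cubes_eq_range image_image L_def V_def split_beta)
      have "blm_norm p q t r (\<lambda>x. f (x - y)) \<le> ennreal K * blm_norm p q t r f"
        unfolding norm_eq
      proof (rule SUP_least)
        fix x
        let ?V = "V (1 / t - 1 / p)"
        have "?V x * L (\<lambda>x. f (x - y)) x \<le> ?V x * (ennreal K * (SUP e\<in>E. L f (\<tau> e x)))"
          by (intro mult_left_mono L_le) auto
        also have "\<dots> = ennreal K * (SUP e\<in>E. ?V (\<tau> e x) * L f (\<tau> e x))"
          by (simp add: V_\<tau> SUP_mult_left_ennreal[symmetric] mult.left_commute)
        also have "\<dots> \<le> ennreal K * (SUP x. ?V x * L f x)"
          by (intro mult_left_mono SUP_least SUP_upper) auto
        finally show "?V x * L (\<lambda>x. f (x - y)) x \<le> ennreal K * (SUP x. ?V x * L f x)" .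
      qed
      \<comment> \<open>Here \<open>1 / enn2real r\<close> is \<open>1 / 0 = 0\<close>, so the extra
        factor is \<open>N powr 0 = 1\<close>.\<close>
      then show ?thesis using N by (simp add: True)
    next
      case False
      define a where "a = enn2real r"
      have a: "0 < a"
        using assms(3) False by (simp add: a_def enn2real_positive_iff top.not_eq_extremum)
      let ?V = "V (a / t - a / p)"
      \<comment> \<open>Unlike a supremum, a sum would count repeated cubes several times, so
        injectivity of the indexing is essential here.\<close>
      have norm_eq: "blm_norm p q t r g
          = ennpowr (\<Sum>\<^sub>\<infinity>x. ?V x * ennpowr (L g x) a) (1 / a)" for g
        unfolding blm_norm_def dyadic_cubes_eq_range infsum_reindex[OF inj_dyadic_cube]
        using False by (simp add: o_def L_def V_def a_def case_prod_unfold)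
      have "(\<Sum>\<^sub>\<infinity>x. ?V x * ennpowr (L (\<lambda>x. f (x - y)) x) a)
          \<le> ennreal (K powr a) * (of_nat (card E) * (\<Sum>\<^sub>\<infinity>x. ?V x * ennpowr (L f x) a))"
      proof (rule infsum_le_sum_infsum_reindex[where \<tau> = \<tau>])
        show "inj (\<tau> e)" for e
          by (auto simp: \<tau>_def inj_def)
        fix x
        have "?V x * ennpowr (L (\<lambda>x. f (x - y)) x) a
            \<le> ?V x * ennpowr (ennreal K * (SUP e\<in>E. L f (\<tau> e x))) a"
          using a by (intro mult_left_mono ennpowr_mono L_le) auto
        also have "\<dots> = ?V x * (ennreal (K powr a) * (SUP e\<in>E. ennpowr (L f (\<tau> e x)) a))"
          using a E K by (simp add: ennpowr_mult ennpowr_ennreal ennpowr_SUP)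
        also have "\<dots> \<le> ?V x * (ennreal (K powr a) * (\<Sum>e\<in>E. ennpowr (L f (\<tau> e x)) a))"
          using E by (intro mult_left_mono SUP_le_sum_ennreal) auto
        also have "\<dots> = ennreal (K powr a) * (\<Sum>e\<in>E. ?V (\<tau> e x) * ennpowr (L f (\<tau> e x)) a)"
          by (simp add: V_\<tau> sum_distrib_left[symmetric] mult.left_commute)
        finally show "?V x * ennpowr (L (\<lambda>x. f (x - y)) x) a
            \<le> ennreal (K powr a) * (\<Sum>e\<in>E. ?V (\<tau> e x) * ennpowr (L f (\<tau> e x)) a)" .
      qed
      also have "(of_nat (card E) :: ennreal) = ennreal N"
        by (simp add: N_def ennreal_of_nat_eq_real_of_nat)
      finally have "blm_norm p q t r (\<lambda>x. f (x - y))
          \<le> ennpowr (ennreal (K powr a) * (ennreal N * (\<Sum>\<^sub>\<infinity>x. ?V x * ennpowr (L f x) a))) (1 / a)"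
        unfolding norm_eq using a by (intro ennpowr_mono) auto
      also have "\<dots> = ennreal (K * N powr (1 / a)) * blm_norm p q t r f"
        using a K N by (simp add: norm_eq ennpowr_mult ennpowr_ennreal powr_powr ennreal_mult mult.assoc)
      finally show ?thesis by (simp add: a_def)
    qed
  qed
  moreover have "0 < K * N powr (1 / enn2real r)"
    using K N by simp
  ultimately show ?thesis by blast
qed

end
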